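(* For any time $t$, the solution returned by $\textsc{Query}_{6+\varepsilon}(t)$ of Algorithm B (described in the context) is a $(6+\varepsilon)$-approximation for the $k$-center problem on the active set $X_t$, i.e., it is a set $C$ of at most $k$ points with $r_C(X_t)\le(6+\varepsilon)\,r_k^*(X_t)$.
   Context: Let $(\mathcal U,d)$ be a metric space, $X\subseteq\mathcal U$ finite, $k\ge1$ an integer. Each $p\in X$ has an arrival time $t_{\rm arr}(p)\in\mathbb N$ and a deletion time $t_{\rm del}(p)\in\mathbb N$ with $t_{\rm arr}(p)<t_{\rm del}(p)$; arrival times are pairwise distinct, and points are presented in order of arrival. The active set at time $t$ is $X_t=\{p\in X: t_{\rm arr}(p)\le t<t_{\rm del}(p)\}$. $d(p,C)=\min_{q\in C}d(p,q)$, $r_C(S)=\max_{p\in S}d(p,C)$, $r_k^*(S)=\min_{C\subseteq S,|C|\le k}r_C(S)$. Let $d_{\min},d_{\max}$ be the minimum and maximum distance between two distinct points of $X$ (assumed known), $\Delta=d_{\max}/d_{\min}$. Let $\varepsilon>0$, $\beta=\varepsilon/6$, and $\Gamma=\{(1+\beta)^i:\lfloor\log_{1+\beta}d_{\min}\rfloor\le i\le\lceil\log_{1+\beta}d_{\max}\rceil\}$. Algorithm B: for each $\gamma\in\Gamma$ it maintains a set $A^\gamma$ of attractors, a map $rep^\gamma$ assigning to each attractor a representative, and a set $R^\gamma$ of representatives (the current representatives of the attractors, plus representatives whose attractors have been removed from $A^\gamma$). Initially all are empty. $\textsc{Update}_{6+\varepsilon}(p)$, called at arrival of $p$: for each $\gamma\in\Gamma$: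 (i) remove from $A^\gamma$ and $R^\gamma$ every $x$ with $t_{\rm del}(x)\le t_{\rm arr}(p)$; (ii) let $E=\{a\in A^\gamma:d(a,p)\le2\gamma\}$; (iii) if $E=\emptyset$: add $p$ to $A^\gamma$, set $rep^\gamma(p)=p$, add $p$ to $R^\gamma$, and run $\textsc{Cleanup}(\gamma)$; (iv) otherwise let $E'=\{a\in E: t_{\rm del}(rep^\gamma(a))<t_{\rm del}(p)\}$; if $E'\ne\emptyset$, pick an arbitrary $a\in E'$, remove $rep^\gamma(a)$ from $R^\gamma$, set $rep^\gamma(a)=p$ and add $p$ to $R^\gamma$; if $E'=\emptyset$, $p$ is discarded. $\textsc{Cleanup}(\gamma)$: if $|A^\gamma|=k+2$, remove from $A^\gamma$ the attractor with minimum deletion time. Then, if $|A^\gamma|=k+1$, let $t_{\min}=\min_{a\in A^\gamma}t_{\rm del}(a)$ and remove from $R^\gamma$ all $q$ with $t_{\rm del}(q)<t_{\min}$. $\textsc{Query}_{6+\varepsilon}(t)$: first, for each $\gamma$, remove from $A^\gamma$ and $R^\gamma$ all points $x$ with $t_{\rm del}(x)\le t$. Then, for increasing $\gamma\in\Gamma$ with $|A^\gamma|\le k$: set $C=\emptyset$; for each $q\in R^\gamma$ in turn, if $C=\emptyset$ or $d(q,C)>2\gamma$ add $q$ to $C$; if at some point $|C|>k$, move to the next $\gamma$; otherwise return $C$.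
   Formalization: The radius bound is claimed only when |X_t| > k or |X_t| ≤ 1: for 2 ≤ |X_t| ≤ k the optimum is 0 but the algorithm may return a set of positive radius (k=2, two points at distance 1 sharing one representative). Also |X| ≥ 2 is assumed so that d_min and d_max exist. *)

theory Defs
  imports "HOL-Analysis.Analysis"
begin

text \<open>
  Values lie in \<open>[0,\<infinity>]\<close>, so that the distance to the empty set is \<open>\<infinity>\<close> and the radius of the
  empty set is \<open>0\<close>. On nonempty finite sets the infima and suprema below are minima and maxima.
\<close>

definition dist_to_set :: "'a::metric_space \<Rightarrow> 'a set \<Rightarrow> ennreal" where
  "dist_to_set p C = (INF q\<in>C. ennreal (dist p q))"

definition radius :: "'a::metric_space set \<Rightarrow> 'a set \<Rightarrow> ennreal" where
  "radius C S = (SUP p\<in>S. dist_to_set p C)"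

definition opt_radius :: "nat \<Rightarrow> 'a::metric_space set \<Rightarrow> ennreal" where
  "opt_radius k S = (INF C\<in>{C. C \<subseteq> S \<and> finite C \<and> card C \<le> k}. radius C S)"

definition active :: "'a set \<Rightarrow> ('a \<Rightarrow> nat) \<Rightarrow> ('a \<Rightarrow> nat) \<Rightarrow> nat \<Rightarrow> 'a set" where
  "active X t_arr t_del t = {p \<in> X. t_arr p \<le> t \<and> t < t_del p}"

definition d_min :: "'a::metric_space set \<Rightarrow> real" where
  "d_min X = Min {dist p q | p q. p \<in> X \<and> q \<in> X \<and> p \<noteq> q}"

definition d_max :: "'a::metric_space set \<Rightarrow> real" where
  "d_max X = Max {dist p q | p q. p \<in> X \<and> q \<in> X \<and> p \<noteq> q}"

definition guesses :: "'a::metric_space set \<Rightarrow> real \<Rightarrow> real set" where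
  "guesses X \<epsilon> = (let \<beta> = \<epsilon> / 6 in
     {(1 + \<beta>) powi i | i :: int. \<lfloor>log (1 + \<beta>) (d_min X)\<rfloor> \<le> i \<and> i \<le> \<lceil>log (1 + \<beta>) (d_max X)\<rceil>})"

text \<open>
  The algorithm is nondeterministic (choice of the attractor whose representative is replaced, ties
  between deletion times, order in which a query scans the representatives), so each
  operation yields the set of its possible results. The function \<open>rep\<close> is only meaningful on
  \<open>attractors\<close>.
\<close>

record 'a guess_state =
  attractors :: "'a set"
  rep :: "'a \<Rightarrow> 'a"
  reps :: "'a set"

type_synonym 'a state = "real \<Rightarrow> 'a guess_state"

definition expire :: "('a \<Rightarrow> nat) \<Rightarrow> nat \<Rightarrow> 'a guess_state \<Rightarrow> 'a guess_state" where
  "expire t_del t s = s\<lparr>attractors := attractors s - {x. t_del x \<le> t},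
                        reps := reps s - {x. t_del x \<le> t}\<rparr>"

definition drop_oldest :: "nat \<Rightarrow> ('a \<Rightarrow> nat) \<Rightarrow> 'a guess_state \<Rightarrow> 'a guess_state set" where
  "drop_oldest k t_del s =
     (if card (attractors s) = k + 2
      then {s\<lparr>attractors := attractors s - {a}\<rparr> | a. is_arg_min t_del (\<lambda>x. x \<in> attractors s) a}
      else {s})"

definition prune_reps :: "nat \<Rightarrow> ('a \<Rightarrow> nat) \<Rightarrow> 'a guess_state \<Rightarrow> 'a guess_state" where
  "prune_reps k t_del s =
     (if card (attractors s) = k + 1
      then let t_min = Min (t_del ` attractors s) in s\<lparr>reps := reps s - {q. t_del q < t_min}\<rparr>
      else s)"

definition cleanup :: "nat \<Rightarrow> ('a \<Rightarrow> nat) \<Rightarrow> 'a guess_state \<Rightarrow> 'a guess_state set" where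
  "cleanup k t_del s = prune_reps k t_del ` drop_oldest k t_del s"

definition update_guess ::
    "nat \<Rightarrow> ('a::metric_space \<Rightarrow> nat) \<Rightarrow> ('a \<Rightarrow> nat) \<Rightarrow> real \<Rightarrow> 'a \<Rightarrow> 'a guess_state \<Rightarrow> 'a guess_state set"
  where
  "update_guess k t_arr t_del \<gamma> p s0 =
     (let s = expire t_del (t_arr p) s0;
          E = {a \<in> attractors s. dist a p \<le> 2 * \<gamma>};
          E' = {a \<in> E. t_del (rep s a) < t_del p}
      in if E = {} then
           cleanup k t_del (s\<lparr>attractors := insert p (attractors s),
                              rep := (rep s)(p := p),
                              reps := insert p (reps s)\<rparr>)
         else if E' = {} then {s}
         else {s\<lparr>rep := (rep s)(a := p), reps := insert p (reps s - {rep s a})\<rparr> | a. a \<in> E'})"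

definition update ::
    "real set \<Rightarrow> nat \<Rightarrow> ('a::metric_space \<Rightarrow> nat) \<Rightarrow> ('a \<Rightarrow> nat) \<Rightarrow> 'a \<Rightarrow> 'a state \<Rightarrow> 'a state set" where
  "update \<Gamma> k t_arr t_del p \<sigma> = (\<Pi>\<^sub>E \<gamma>\<in>\<Gamma>. update_guess k t_arr t_del \<gamma> p (\<sigma> \<gamma>))"

definition purge :: "real set \<Rightarrow> ('a \<Rightarrow> nat) \<Rightarrow> nat \<Rightarrow> 'a state \<Rightarrow> 'a state" where
  "purge \<Gamma> t_del t \<sigma> = (\<lambda>\<gamma>\<in>\<Gamma>. expire t_del t (\<sigma> \<gamma>))"

fun greedy :: "nat \<Rightarrow> real \<Rightarrow> 'a::metric_space list \<Rightarrow> 'a set \<Rightarrow> 'a set option" where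
  "greedy k \<gamma> [] C = Some C"
| "greedy k \<gamma> (q # qs) C =
     (let C' = (if C = {} \<or> dist_to_set q C > ennreal (2 * \<gamma>) then insert q C else C)
      in if card C' > k then None else greedy k \<gamma> qs C')"

text \<open>The result \<open>None\<close> means that every guess has been tried without success.\<close>

fun scan :: "nat \<Rightarrow> 'a::metric_space state \<Rightarrow> real list \<Rightarrow> 'a set option set" where
  "scan k \<sigma> [] = {None}"
| "scan k \<sigma> (\<gamma> # \<gamma>s) =
     (if card (attractors (\<sigma> \<gamma>)) \<le> k
      then (\<Union>qs\<in>{qs. distinct qs \<and> set qs = reps (\<sigma> \<gamma>)}.
              case greedy k \<gamma> qs {} of Some C \<Rightarrow> {Some C} | None \<Rightarrow> scan k \<sigma> \<gamma>s)
      else scan k \<sigma> \<gamma>s)"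

definition query :: "real set \<Rightarrow> nat \<Rightarrow> ('a::metric_space \<Rightarrow> nat) \<Rightarrow> nat \<Rightarrow> 'a state \<Rightarrow> 'a set option set"
  where
  "query \<Gamma> k t_del t \<sigma> = scan k (purge \<Gamma> t_del t \<sigma>) (sorted_list_of_set \<Gamma>)"

definition initial_state :: "real set \<Rightarrow> 'a state" where
  "initial_state \<Gamma> = (\<lambda>\<gamma>\<in>\<Gamma>. \<lparr>attractors = {}, rep = (\<lambda>_. undefined), reps = {}\<rparr>)"

definition arrivals ::
    "real set \<Rightarrow> nat \<Rightarrow> 'a::metric_space set \<Rightarrow> ('a \<Rightarrow> nat) \<Rightarrow> ('a \<Rightarrow> nat) \<Rightarrow> nat \<Rightarrow> 'a state \<Rightarrow> 'a state set"
  where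
  "arrivals \<Gamma> k X t_arr t_del t \<sigma> =
     (if \<exists>p\<in>X. t_arr p = t
      then \<Union>p\<in>{p \<in> X. t_arr p = t}. update \<Gamma> k t_arr t_del p \<sigma>
      else {\<sigma>})"

text \<open>
  \<open>states_before \<Gamma> k X t_arr t_del t\<close>: the possible states after all events at times \<open>< t\<close>.
  At each time the point arriving then (if any) is processed first; afterwards the
  algorithm may or may not be queried, and a query leaves the purged state behind.
\<close>

primrec states_before ::
    "real set \<Rightarrow> nat \<Rightarrow> 'a::metric_space set \<Rightarrow> ('a \<Rightarrow> nat) \<Rightarrow> ('a \<Rightarrow> nat) \<Rightarrow> nat \<Rightarrow> 'a state set" where
  "states_before \<Gamma> k X t_arr t_del 0 = {initial_state \<Gamma>}"
| "states_before \<Gamma> k X t_arr t_del (Suc t) =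
     (\<Union>\<sigma>\<in>states_before \<Gamma> k X t_arr t_del t.
        \<Union>\<sigma>'\<in>arrivals \<Gamma> k X t_arr t_del t \<sigma>. {\<sigma>', purge \<Gamma> t_del t \<sigma>'})"

text \<open>
  The possible results of a query at time \<open>t\<close>, which takes place after the arrivals at times \<open>\<le> t\<close>.

  Pitfall: for \<open>2 \<le> card (active X t_arr t_del t) \<le> k\<close> a result need not be optimal although
  \<open>opt_radius\<close> is \<open>0\<close>. The smallest guess \<open>\<gamma>\<close> only satisfies \<open>d_min / (1 + \<epsilon>/6) < \<gamma> \<le> d_min\<close>, so
  two points at distance \<open>d_min\<close> may share a single representative. For instance, let \<open>k = 2\<close> and
  \<open>X = {x, y}\<close> with \<open>dist x y = 1\<close>, where \<open>x\<close> is present during \<open>[0, 10)\<close> and \<open>y\<close> during \<open>[1, 11)\<close>.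
  The only guess is \<open>1\<close>, and the query at time \<open>1\<close> returns \<open>{y}\<close>, which has radius \<open>1\<close>.
\<close>

definition query_results ::
    "'a::metric_space set \<Rightarrow> ('a \<Rightarrow> nat) \<Rightarrow> ('a \<Rightarrow> nat) \<Rightarrow> nat \<Rightarrow> real \<Rightarrow> nat \<Rightarrow> 'a set option set" where
  "query_results X t_arr t_del k \<epsilon> t =
     (let \<Gamma> = guesses X \<epsilon> in
      \<Union>\<sigma>\<in>states_before \<Gamma> k X t_arr t_del (Suc t). query \<Gamma> k t_del t \<sigma>)"

end

theory Submission
  imports Defs
begin

text \<open>
  For each guess \<open>\<gamma>\<close> every live point is accounted for in one of three ways: it lies within
  \<open>2 * \<gamma>\<close> of a current attractor whose representative outlives it; or it lies within \<open>4 * \<gamma>\<close> of an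
  orphaned representative (one whose attractor is gone) that outlives it; or there are \<open>k + 1\<close>
  attractors, all of which outlive it. The third case disappears as soon as one of these attractors
  expires, and a representative is only ever replaced while it belongs to an attractor, so the
  trichotomy persists. If at most \<open>k\<close> attractors are alive, all active points are therefore within
  \<open>4 * \<gamma>\<close> of the representatives, hence within \<open>6 * \<gamma>\<close> of the centers chosen greedily. A rejected
  guess exhibits \<open>k + 1\<close> active points at mutual distance \<open>> 2 * \<gamma>\<close>, so \<open>\<gamma>\<close> is a lower bound for the
  optimum; apply this to the guess preceding the accepted one (or, if there is none, use \<open>\<gamma> \<le> d_min X\<close>).
\<close>

section \<open>Distances and separated sets\<close>

text \<open>Strict, like the tests of the algorithm: a point becomes an attractor or a center only
  at distance \<open>> 2 * \<gamma>\<close> from those already present, while two points sharing a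
  center within \<open>r\<close> are at distance at most \<open>2 * r\<close>.\<close>

definition separated :: "real \<Rightarrow> 'a::metric_space set \<Rightarrow> bool" where
  "separated r D \<longleftrightarrow> (\<forall>x\<in>D. \<forall>y\<in>D. x \<noteq> y \<longrightarrow> r < dist x y)"

lemma separated_subset: "separated r D \<Longrightarrow> E \<subseteq> D \<Longrightarrow> separated r E"
  by (auto simp: separated_def)

lemma separated_insert:
  assumes "separated r D" "\<And>x. x \<in> D \<Longrightarrow> r < dist x p"
  shows "separated r (insert p D)"
  using assms by (auto simp: separated_def dist_commute)

lemma dist_to_set_le: "c \<in> C \<Longrightarrow> dist_to_set p C \<le> ennreal (dist p c)"
  unfolding dist_to_set_def by (rule INF_lower)

lemma dist_to_set_leD:
  assumes "finite C" "0 \<le> r" "dist_to_set p C \<le> ennreal r"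
  obtains c where "c \<in> C" "dist p c \<le> r"
proof -
  \<comment> \<open>The distance to the empty set is infinite, so a real bound forces a center to
    exist.\<close>
  have "C \<noteq> {}"
    using assms(3) by (auto simp: dist_to_set_def top_unique)
  then have "dist_to_set p C \<in> (\<lambda>q. ennreal (dist p q)) ` C"
    unfolding dist_to_set_def using assms(1)
    by (metis (no_types, lifting) Min_Inf Min_in finite_imageI image_is_empty)
  then show thesis
    using that assms(2,3) by auto
qed

lemma radius_leI:
  assumes "\<And>p. p \<in> S \<Longrightarrow> \<exists>c\<in>C. dist p c \<le> r"
  shows "radius C S \<le> ennreal r"
  unfolding radius_def
proof (rule SUP_least)
  fix p assume "p \<in> S"
  then obtain c where "c \<in> C" "dist p c \<le> r"
    using assms by blast
  then show "dist_to_set p C \<le> ennreal r"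
    using dist_to_set_le[of c C p] ennreal_leI order_trans by blast
qed

text \<open>Pigeonhole: at most \<open>k\<close> centers of radius at most \<open>r\<close> would
  serve two points of \<open>D\<close> from one center, and these two would be at distance at most
  \<open>2 * r\<close>.\<close>

lemma opt_radius_ge_separated:
  assumes "D \<subseteq> S" "finite D" "k < card D" "separated (2 * r) D" "0 \<le> r"
  shows "ennreal r \<le> opt_radius k S"
  unfolding opt_radius_def
proof (rule INF_greatest, rule ccontr)
  fix C assume C: "C \<in> {C. C \<subseteq> S \<and> finite C \<and> card C \<le> k}" and "\<not> ennreal r \<le> radius C S"
  then have "dist_to_set p C \<le> ennreal r" if "p \<in> D" for p
    using SUP_upper[of p S "\<lambda>p. dist_to_set p C"] assms(1) that unfolding radius_def
    by (meson less_imp_le not_le order_trans subsetD)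
  then have "\<forall>p\<in>D. \<exists>c\<in>C. dist p c \<le> r"
    using C assms(5) by (metis (no_types, lifting) dist_to_set_leD mem_Collect_eq)
  then obtain f where f: "\<And>p. p \<in> D \<Longrightarrow> f p \<in> C \<and> dist p (f p) \<le> r"
    by metis
  then have "\<not> inj_on f D"
    using card_inj_on_le[of f D C] C assms(3) by auto
  then obtain p q where pq: "p \<in> D" "q \<in> D" "p \<noteq> q" "f p = f q"
    by (auto simp: inj_on_def)
  then have "dist p q \<le> 2 * r"
    using f[of p] f[of q] dist_triangle2[of p q "f p"] by auto
  then show False
    using pq assms(4) unfolding separated_def by (meson not_le)
qed

section \<open>The invariant of a single guess\<close>

text \<open>Below, \<open>P\<close> is the set of points that have arrived so far and \<open>Q\<close> the subset still to be covered.\<close>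

definition coherent ::
    "('a::metric_space \<Rightarrow> nat) \<Rightarrow> real \<Rightarrow> 'a set \<Rightarrow> 'a guess_state \<Rightarrow> bool" where
  "coherent t_del \<gamma> P s \<longleftrightarrow>
     attractors s \<subseteq> P \<and> reps s \<subseteq> P \<and> separated (2 * \<gamma>) (attractors s) \<and>
     inj_on (rep s) (attractors s) \<and>
     (\<forall>a\<in>attractors s. rep s a \<in> reps s \<and> dist a (rep s a) \<le> 2 * \<gamma> \<and> t_del a \<le> t_del (rep s a))"

text \<open>While the attractor exists, distance is measured to it and not to its representative:
  replacements stay near the same attractor, so errors do not accumulate. Once the attractor is
  gone, its last representative is never replaced again, and \<open>4 * \<gamma>\<close> adds the
  two hops via the lost attractor.\<close>

definition covered :: "('a::metric_space \<Rightarrow> nat) \<Rightarrow> real \<Rightarrow> 'a guess_state \<Rightarrow> 'a \<Rightarrow> bool" where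
  "covered t_del \<gamma> s q \<longleftrightarrow>
     (\<exists>a\<in>attractors s. dist q a \<le> 2 * \<gamma> \<and> t_del q \<le> t_del (rep s a)) \<or>
     (\<exists>r\<in>reps s - rep s ` attractors s. dist q r \<le> 4 * \<gamma> \<and> t_del q \<le> t_del r)"

text \<open>The strict inequality ensures that no attractor expires while \<open>q\<close> is alive,
  and it matches the pruning of representatives with deletion time strictly below
  \<open>t_min\<close>.\<close>

definition outlived :: "nat \<Rightarrow> ('a \<Rightarrow> nat) \<Rightarrow> 'a guess_state \<Rightarrow> 'a \<Rightarrow> bool" where
  "outlived k t_del s q \<longleftrightarrow>
     card (attractors s) = k + 1 \<and> (\<forall>a\<in>attractors s. t_del q < t_del a)"

definition guess_inv ::
    "nat \<Rightarrow> ('a::metric_space \<Rightarrow> nat) \<Rightarrow> real \<Rightarrow> 'a set \<Rightarrow> 'a set \<Rightarrow> 'a guess_state \<Rightarrow> bool" where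
  "guess_inv k t_del \<gamma> P Q s \<longleftrightarrow>
     coherent t_del \<gamma> P s \<and> card (attractors s) \<le> k + 1 \<and>
     (\<forall>q\<in>Q. covered t_del \<gamma> s q \<or> outlived k t_del s q)"

lemma guess_inv_mono: "guess_inv k t_del \<gamma> P Q s \<Longrightarrow> Q' \<subseteq> Q \<Longrightarrow> guess_inv k t_del \<gamma> P Q' s"
  by (auto simp: guess_inv_def)

lemma covered_near_rep:
  assumes "coherent t_del \<gamma> P s" "covered t_del \<gamma> s q"
  obtains r where "r \<in> reps s" "dist q r \<le> 4 * \<gamma>" "t_del q \<le> t_del r"
  using assms(2) unfolding covered_def
proof (elim disjE bexE conjE)
  fix a assume a: "a \<in> attractors s" "dist q a \<le> 2 * \<gamma>" "t_del q \<le> t_del (rep s a)"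
  with assms(1) have "rep s a \<in> reps s" "dist a (rep s a) \<le> 2 * \<gamma>"
    by (auto simp: coherent_def)
  then show thesis
    using a that dist_triangle[of q "rep s a" a] by force
qed (use that in auto)

section \<open>Preservation of the invariant under expiry, cleanup and updates\<close>

lemma coherent_remove:
  assumes "coherent t_del \<gamma> P s" "A \<subseteq> attractors s" "R \<subseteq> reps s" "rep s ` A \<subseteq> R"
  shows "coherent t_del \<gamma> P (s\<lparr>attractors := A, reps := R\<rparr>)"
  using assms by (auto simp: coherent_def intro: separated_subset inj_on_subset)

text \<open>Removing attractors turns points covered through them into points covered by orphans.\<close>

lemma covered_remove:
  assumes "coherent t_del \<gamma> P s" "covered t_del \<gamma> s q" "A \<subseteq> attractors s"
    and R: "\<And>r. r \<in> reps s \<Longrightarrow> t_del q \<le> t_del r \<Longrightarrow> r \<in> R"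
  shows "covered t_del \<gamma> (s\<lparr>attractors := A, reps := R\<rparr>) q"
proof -
  consider (attractor) a where "a \<in> attractors s" "dist q a \<le> 2 * \<gamma>" "t_del q \<le> t_del (rep s a)"
    | (orphan) r where "r \<in> reps s - rep s ` attractors s" "dist q r \<le> 4 * \<gamma>" "t_del q \<le> t_del r"
    using assms(2) by (auto simp: covered_def)
  then show ?thesis
  proof cases
    case attractor
    have "rep s a \<in> reps s" "dist a (rep s a) \<le> 2 * \<gamma>"
      using assms(1) attractor(1) by (auto simp: coherent_def)
    then have rep: "rep s a \<in> R" "dist q (rep s a) \<le> 4 * \<gamma>"
      using attractor R dist_triangle[of q "rep s a" a] by auto
    show ?thesis
    proof (cases "a \<in> A")
      case False
      \<comment> \<open>Injectivity of \<open>rep s\<close> makes this representative an orphan: no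
        surviving attractor shares it.\<close>
      then have "rep s a \<notin> rep s ` A"
        using inj_on_image_mem_iff[OF _ attractor(1) assms(3)] assms(1)
        by (auto simp: coherent_def)
      then show ?thesis
        using rep attractor by (auto simp: covered_def)
    qed (use attractor in \<open>auto simp: covered_def\<close>)
  next
    case orphan
    then have "r \<in> R - rep s ` A"
      using R[of r] assms(3) by auto
    then show ?thesis
      using orphan by (auto simp: covered_def)
  qed
qed

text \<open>A representative covering a live point is deleted no earlier than that point, hence is
  alive as well; a surviving attractor keeps its representative for the same reason. If a live point
  is outlived, none of the \<open>k + 1\<close> attractors expires.\<close>

lemma guess_inv_expire:
  assumes inv: "guess_inv k t_del \<gamma> P Q s" and "finite P" "Q' \<subseteq> Q" "\<And>q. q \<in> Q' \<Longrightarrow> t < t_del q"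
  shows "guess_inv k t_del \<gamma> P Q' (expire t_del t s)"
proof -
  let ?A = "attractors s - {x. t_del x \<le> t}" and ?R = "reps s - {x. t_del x \<le> t}"
  have coh: "coherent t_del \<gamma> P s"
    using inv by (simp add: guess_inv_def)
  have "finite (attractors s)"
    using coh \<open>finite P\<close> by (auto simp: coherent_def intro: finite_subset)
  then have "card ?A \<le> k + 1"
    using inv card_mono[of "attractors s" ?A] by (auto simp: guess_inv_def)
  moreover have "coherent t_del \<gamma> P (expire t_del t s)"
    unfolding expire_def using coh by (intro coherent_remove) (force simp: coherent_def)+
  moreover have "covered t_del \<gamma> (expire t_del t s) q \<or> outlived k t_del (expire t_del t s) q"
    if "q \<in> Q'" for q
  proof -
    have q: "t < t_del q" "covered t_del \<gamma> s q \<or> outlived k t_del s q"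
      using inv that assms(3,4) by (auto simp: guess_inv_def)
    from q(2) show ?thesis
    proof
      assume "covered t_del \<gamma> s q"
      then show ?thesis
        unfolding expire_def using coh q(1) by (intro disjI1 covered_remove) auto
    next
      assume "outlived k t_del s q"
      moreover from this have "?A = attractors s"
        using q(1) by (force simp: outlived_def)
      ultimately show ?thesis
        by (auto simp: outlived_def expire_def)
    qed
  qed
  ultimately show ?thesis
    by (auto simp: guess_inv_def expire_def)
qed

text \<open>A pruned representative is deleted before all \<open>k + 1\<close> attractors, so a
  point that relied on it, being deleted no later, is outlived.\<close>

lemma guess_inv_prune_reps:
  assumes coh: "coherent t_del \<gamma> P s" and "finite P" "card (attractors s) \<le> k + 1"
    and cov: "\<And>q. q \<in> Q \<Longrightarrow> covered t_del \<gamma> s q \<or> outlived k t_del s q"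
  shows "guess_inv k t_del \<gamma> P Q (prune_reps k t_del s)"
proof (cases "card (attractors s) = k + 1")
  case True
  define m where "m = Min (t_del ` attractors s)"
  \<comment> \<open>The attractors are written back unchanged so that the state has the shape
    required by \<open>coherent_remove\<close> and \<open>covered_remove\<close>.\<close>
  let ?s = "s\<lparr>attractors := attractors s, reps := reps s - {q. t_del q < m}\<rparr>"
  have s': "prune_reps k t_del s = ?s"
    using True by (simp add: prune_reps_def m_def)
  have fin: "finite (attractors s)" and ne: "attractors s \<noteq> {}"
    using True card.infinite by fastforce+
  have le: "m \<le> t_del a" if "a \<in> attractors s" for a
    using fin that by (simp add: m_def)
  have "coherent t_del \<gamma> P ?s"
    using coh le by (intro coherent_remove) (force simp: coherent_def)+
  moreover have "covered t_del \<gamma> ?s q \<or> outlived k t_del ?s q" if "q \<in> Q" for q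
  proof (cases "t_del q < m")
    case True
    then show ?thesis
      using \<open>card (attractors s) = k + 1\<close> le by (force simp: outlived_def)
  next
    case False
    \<comment> \<open>The minimum is attained, so a \<open>q\<close> with deletion time at least
      \<open>m\<close> is not outlived and must be covered; what covers it is deleted no earlier
      than \<open>m\<close> and is kept.\<close>
    moreover have "m \<in> t_del ` attractors s"
      unfolding m_def using fin ne by (intro Min_in) auto
    ultimately have "\<not> outlived k t_del s q"
      by (auto simp: outlived_def)
    then have "covered t_del \<gamma> s q"
      using cov that by blast
    then show ?thesis
      using coh False by (intro disjI1 covered_remove) auto
  qed
  ultimately show ?thesis
    using True unfolding s' by (simp add: guess_inv_def)
qed (use assms in \<open>simp add: prune_reps_def guess_inv_def\<close>)

text \<open>The delicate case is that of \<open>k + 2\<close> attractors. A point outlived by the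
  \<open>k + 1\<close> old ones stays outlived when \<open>p\<close> joins and an attractor of
  smallest deletion time is dropped; a point covered through the dropped attractor becomes covered
  by an orphan.\<close>

lemma guess_inv_cleanup:
  assumes inv: "guess_inv k t_del \<gamma> P Q s" and P: "finite P" "p \<notin> P"
    and far: "\<And>a. a \<in> attractors s \<Longrightarrow> 2 * \<gamma> < dist a p" and "0 \<le> \<gamma>"
    and Q': "Q' \<subseteq> insert p Q"
    and s': "s' \<in> cleanup k t_del (s\<lparr>attractors := insert p (attractors s),
                              rep := (rep s)(p := p), reps := insert p (reps s)\<rparr>)"
  shows "guess_inv k t_del \<gamma> (insert p P) Q' s'"
proof -
  define s1 where "s1 = s\<lparr>attractors := insert p (attractors s),
                              rep := (rep s)(p := p), reps := insert p (reps s)\<rparr>"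
  have coh: "coherent t_del \<gamma> P s"
    using inv by (simp add: guess_inv_def)
  have p: "p \<notin> attractors s" "p \<notin> reps s"
    using coh P by (auto simp: coherent_def)
  have im: "rep s1 ` attractors s1 = insert p (rep s ` attractors s)"
    using p by (force simp: s1_def)
  have repP: "rep s ` attractors s \<subseteq> reps s"
    using coh by (auto simp: coherent_def)
  have "inj_on (rep s1) (attractors s1)"
    using coh p repP unfolding s1_def by (force simp: coherent_def inj_on_def)
  then have coh1: "coherent t_del \<gamma> (insert p P) s1"
    using coh p far \<open>0 \<le> \<gamma>\<close> by (auto simp: coherent_def s1_def intro!: separated_insert)
  have fin: "finite (attractors s)"
    using coh P by (auto simp: coherent_def intro: finite_subset)
  have card1: "card (attractors s1) = card (attractors s) + 1" "card (attractors s1) \<le> k + 2"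
    using fin p inv by (auto simp: s1_def guess_inv_def)
  \<comment> \<open>Here \<open>outlived\<close> refers to the state \<open>s\<close> before the
    insertion: the \<open>k + 2\<close> attractors of \<open>s1\<close> would violate the count in
    its definition.\<close>
  have cov1: "covered t_del \<gamma> s1 q \<or> outlived k t_del s q" if "q \<in> Q'" for q
  proof -
    have "covered t_del \<gamma> s1 p"
      using \<open>0 \<le> \<gamma>\<close> by (auto simp: covered_def s1_def)
    moreover have "covered t_del \<gamma> s1 q" if cov: "covered t_del \<gamma> s q"
    proof -
      consider (attractor) a where "a \<in> attractors s" "dist q a \<le> 2 * \<gamma>" "t_del q \<le> t_del (rep s a)"
        | (orphan) r where "r \<in> reps s - rep s ` attractors s" "dist q r \<le> 4 * \<gamma>" "t_del q \<le> t_del r"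
        using cov by (auto simp: covered_def)
      then show ?thesis
      proof cases
        case attractor
        then show ?thesis
          using p unfolding covered_def by (intro disjI1 bexI[of _ a]) (auto simp: s1_def)
      next
        case orphan
        \<comment> \<open>As \<open>p\<close> is fresh, the owned representatives grow by
          \<open>p\<close> alone and every orphan stays one.\<close>
        then have "r \<in> reps s1 - rep s1 ` attractors s1"
          using p unfolding im by (auto simp: s1_def)
        then show ?thesis
          using orphan unfolding covered_def by blast
      qed
    qed
    ultimately show ?thesis
      using inv that Q' by (auto simp: guess_inv_def)
  qed
  obtain s2 where s2: "s2 \<in> drop_oldest k t_del s1" "s' = prune_reps k t_del s2"
    using s' by (auto simp: cleanup_def s1_def)
  have "coherent t_del \<gamma> (insert p P) s2 \<and> card (attractors s2) \<le> k + 1 \<and>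
    (\<forall>q\<in>Q'. covered t_del \<gamma> s2 q \<or> outlived k t_del s2 q)"
  proof (cases "card (attractors s1) = k + 2")
    case True
    then obtain a where a: "is_arg_min t_del (\<lambda>x. x \<in> attractors s1) a"
      and "s2 = s1\<lparr>attractors := attractors s1 - {a}\<rparr>"
      using s2(1) by (auto simp: drop_oldest_def)
    then have eq: "s2 = s1\<lparr>attractors := attractors s1 - {a}, reps := reps s1\<rparr>"
      by simp
    have a_in: "a \<in> attractors s1" and a_min: "\<And>x. x \<in> attractors s1 \<Longrightarrow> t_del a \<le> t_del x"
      using a by (auto simp: is_arg_min_linorder)
    have card2: "card (attractors s2) = k + 1"
      using True a_in eq by simp
    have "coherent t_del \<gamma> (insert p P) s2"
      unfolding eq using coh1 by (intro coherent_remove) (auto simp: coherent_def)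
    moreover have "covered t_del \<gamma> s2 q \<or> outlived k t_del s2 q" if "q \<in> Q'" for q
      using cov1[OF that]
    proof
      assume "covered t_del \<gamma> s1 q"
      then show ?thesis
        unfolding eq using coh1 by (intro disjI1 covered_remove) auto
    next
      assume "outlived k t_del s q"
      then have less: "\<And>x. x \<in> attractors s \<Longrightarrow> t_del q < t_del x"
        by (auto simp: outlived_def)
      \<comment> \<open>If \<open>x\<close> is the new attractor \<open>p\<close>, the dropped
        \<open>a\<close> is an old one, so \<open>q\<close> is deleted before \<open>a\<close>, and
        \<open>a\<close> no later than \<open>p\<close>.\<close>
      have "t_del q < t_del x" if "x \<in> attractors s1 - {a}" for x
      proof (cases "x = p")
        case True
        then have "a \<in> attractors s"
          using that a_in by (auto simp: s1_def)
        then show ?thesis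
          using less[of a] a_min[of x] that by auto
      qed (use that less in \<open>auto simp: s1_def\<close>)
      then show ?thesis
        using card2 eq by (auto simp: outlived_def)
    qed
    ultimately show ?thesis
      using card2 by simp
  next
    case False
    \<comment> \<open>In this case the old state had at most \<open>k\<close> attractors.\<close>
    then have "\<not> outlived k t_del s q" for q
      using card1 by (auto simp: outlived_def)
    moreover have "s2 = s1"
      using False s2(1) by (simp add: drop_oldest_def)
    ultimately show ?thesis
      using coh1 cov1 card1 False by auto
  qed
  then show ?thesis
    unfolding s2(2) using P by (intro guess_inv_prune_reps) auto
qed

text \<open>Coverage through \<open>a\<close> survives because \<open>a\<close> stays in place and
  its new representative lives longer. The removed \<open>rep s a\<close> belongs to
  \<open>a\<close> and is thus no orphan on which a point could rely; freshness of \<open>p\<close>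
  preserves injectivity.\<close>

lemma guess_inv_replace:
  assumes inv: "guess_inv k t_del \<gamma> P Q s" and p: "p \<notin> P"
    and a: "a \<in> attractors s" "dist a p \<le> 2 * \<gamma>" "t_del (rep s a) < t_del p"
    and Q': "Q' \<subseteq> insert p Q"
  shows "guess_inv k t_del \<gamma> (insert p P) Q'
    (s\<lparr>rep := (rep s)(a := p), reps := insert p (reps s - {rep s a})\<rparr>)"
    (is "guess_inv _ _ _ _ _ ?s")
proof -
  have coh: "coherent t_del \<gamma> P s"
    using inv by (simp add: guess_inv_def)
  have fresh: "p \<notin> attractors s" "p \<notin> reps s"
    using coh p by (auto simp: coherent_def)
  have inj: "x = y" if "x \<in> attractors s" "y \<in> attractors s" "rep s x = rep s y" for x y
    using coh that by (auto simp: coherent_def inj_on_def)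
  have rep: "rep s x \<in> reps s" "rep s x \<noteq> p" "dist x (rep s x) \<le> 2 * \<gamma>" "t_del x \<le> t_del (rep s x)"
    if "x \<in> attractors s" for x
    using coh fresh that by (auto simp: coherent_def)
  have "inj_on (rep ?s) (attractors ?s)"
    using rep(2) inj by (simp add: inj_on_def) metis
  then have "coherent t_del \<gamma> (insert p P) ?s"
    using coh a rep(1,3,4) inj order_trans[OF rep(4)[OF a(1)] less_imp_le[OF a(3)]]
    by (auto simp: coherent_def)
  moreover have "covered t_del \<gamma> ?s q \<or> outlived k t_del ?s q" if "q \<in> Q'" for q
  proof (cases "q = p")
    case True
    then show ?thesis
      using a by (auto simp: covered_def dist_commute)
  next
    case False
    then have "covered t_del \<gamma> s q \<or> outlived k t_del s q"
      using that Q' inv by (auto simp: guess_inv_def)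
    then consider
      (attractor) b where "b \<in> attractors s" "dist q b \<le> 2 * \<gamma>" "t_del q \<le> t_del (rep s b)"
      | (orphan) r where "r \<in> reps s - rep s ` attractors s" "dist q r \<le> 4 * \<gamma>" "t_del q \<le> t_del r"
      | "outlived k t_del s q"
      by (auto simp: covered_def)
    then show ?thesis
    proof cases
      case attractor
      then show ?thesis
        using a unfolding covered_def by (intro disjI1 bexI[of _ b]) auto
    next
      case orphan
      then have "r \<in> reps ?s - rep ?s ` attractors ?s"
        using a(1) fresh by auto
      then show ?thesis
        using orphan unfolding covered_def by blast
    qed (simp add: outlived_def)
  qed
  ultimately show ?thesis
    using inv by (auto simp: guess_inv_def)
qed

lemma guess_inv_discard:
  assumes inv: "guess_inv k t_del \<gamma> P Q s"
    and a: "a \<in> attractors s" "dist a p \<le> 2 * \<gamma>" "t_del p \<le> t_del (rep s a)"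
    and Q': "Q' \<subseteq> insert p Q"
  shows "guess_inv k t_del \<gamma> (insert p P) Q' s"
proof -
  have "covered t_del \<gamma> s p"
    using a by (auto simp: covered_def dist_commute)
  then show ?thesis
    using inv Q' by (auto simp: guess_inv_def coherent_def)
qed

lemma guess_inv_update:
  assumes inv: "guess_inv k t_del \<gamma> P Q s0" and P: "finite P" "p \<notin> P" and "0 \<le> \<gamma>"
    and Q': "Q' \<subseteq> insert p {q \<in> Q. t_arr p < t_del q}"
    and s': "s' \<in> update_guess k t_arr t_del \<gamma> p s0"
  shows "guess_inv k t_del \<gamma> (insert p P) Q' s'"
proof -
  define s where "s = expire t_del (t_arr p) s0"
  define E where "E = {a \<in> attractors s. dist a p \<le> 2 * \<gamma>}"
  define E' where "E' = {a \<in> E. t_del (rep s a) < t_del p}"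
  have inv_s: "guess_inv k t_del \<gamma> P {q \<in> Q. t_arr p < t_del q} s"
    unfolding s_def using inv P(1) by (rule guess_inv_expire) auto
  have upd: "s' \<in> (if E = {} then
           cleanup k t_del (s\<lparr>attractors := insert p (attractors s),
                              rep := (rep s)(p := p),
                              reps := insert p (reps s)\<rparr>)
         else if E' = {} then {s}
         else {s\<lparr>rep := (rep s)(a := p), reps := insert p (reps s - {rep s a})\<rparr> | a. a \<in> E'})"
    using s' unfolding update_guess_def Let_def s_def E'_def E_def .
  consider "E = {}" | "E \<noteq> {}" "E' = {}" | "E \<noteq> {}" "E' \<noteq> {}"
    by blast
  then show ?thesis
  proof cases
    case 1
    then have "2 * \<gamma> < dist a p" if "a \<in> attractors s" for a
      using that by (force simp: E_def)
    then show ?thesis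
      using guess_inv_cleanup[OF inv_s P _ \<open>0 \<le> \<gamma>\<close> Q'] upd 1 by simp
  next
    case 2
    then obtain a where "a \<in> attractors s" "dist a p \<le> 2 * \<gamma>" "t_del p \<le> t_del (rep s a)"
      by (force simp: E_def E'_def)
    then show ?thesis
      using guess_inv_discard[OF inv_s _ _ _ Q'] upd 2 by simp
  next
    case 3
    then obtain a where "a \<in> E'"
      and s'_eq: "s' = s\<lparr>rep := (rep s)(a := p), reps := insert p (reps s - {rep s a})\<rparr>"
      using upd by auto
    then show ?thesis
      unfolding s'_eq by (intro guess_inv_replace[OF inv_s P(2) _ _ _ Q']) (auto simp: E_def E'_def)
  qed
qed

text \<open>Needed for the existence of results: finiteness provides the attractor of minimal
  deletion time that \<open>drop_oldest\<close> removes.\<close>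

lemma update_guess_nonempty:
  assumes "finite (attractors s)"
  shows "update_guess k t_arr t_del \<gamma> p s \<noteq> {}"
proof -
  have "drop_oldest k t_del s' \<noteq> {}" if "finite (attractors s')" for s'
  proof (cases "card (attractors s') = k + 2")
    case True
    then have "attractors s' \<noteq> {}"
      by auto
    then show ?thesis
      using ex_is_arg_min_if_finite[OF that, of t_del] True by (auto simp: drop_oldest_def)
  qed (simp add: drop_oldest_def)
  then show ?thesis
    using assms by (auto simp: update_guess_def Let_def cleanup_def expire_def)
qed

section \<open>Queries\<close>

lemma greedy_Some:
  assumes "greedy k \<gamma> qs C0 = Some C" "finite C0" "card C0 \<le> k" "0 \<le> \<gamma>"
  shows "C0 \<subseteq> C \<and> C \<subseteq> C0 \<union> set qs \<and> card C \<le> k \<and> (\<forall>q\<in>set qs. \<exists>c\<in>C. dist q c \<le> 2 * \<gamma>)"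
  using assms
proof (induction qs arbitrary: C0)
  case (Cons q qs)
  define C' where "C' = (if C0 = {} \<or> dist_to_set q C0 > ennreal (2 * \<gamma>) then insert q C0 else C0)"
  have C': "card C' \<le> k" "greedy k \<gamma> qs C' = Some C"
    using Cons.prems(1) by (auto simp: C'_def[symmetric] Let_def split: if_splits)
  have "\<exists>c\<in>C'. dist q c \<le> 2 * \<gamma>"
  proof (cases "C0 = {} \<or> dist_to_set q C0 > ennreal (2 * \<gamma>)")
    case False
    then show ?thesis
      using Cons.prems(2,4) dist_to_set_leD[of C0 "2 * \<gamma>" q] by (auto simp: C'_def not_less)
  qed (use Cons.prems in \<open>auto simp: C'_def\<close>)
  moreover have "C0 \<subseteq> C'" "C' \<subseteq> insert q C0" "finite C'"
    using Cons.prems(2) by (auto simp: C'_def)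
  ultimately show ?case
    using Cons.IH[OF C'(2) _ C'(1) Cons.prems(4)] by auto
qed simp

text \<open>The overflowing set is itself the witness, since each point added is more than
  \<open>2 * \<gamma>\<close> away from the earlier ones. Separation of the accumulator
  \<open>C0\<close> carries the induction.\<close>

lemma greedy_None:
  assumes "greedy k \<gamma> qs C0 = None" "finite C0" "separated (2 * \<gamma>) C0" "0 \<le> \<gamma>"
  shows "\<exists>D \<subseteq> C0 \<union> set qs. finite D \<and> k < card D \<and> separated (2 * \<gamma>) D"
  using assms
proof (induction qs arbitrary: C0)
  case (Cons q qs)
  define C' where "C' = (if C0 = {} \<or> dist_to_set q C0 > ennreal (2 * \<gamma>) then insert q C0 else C0)"
  have C': "C' \<subseteq> insert q C0" "finite C'"
    using Cons.prems(2) by (auto simp: C'_def)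
  have "2 * \<gamma> < dist x q" if "dist_to_set q C0 > ennreal (2 * \<gamma>)" "x \<in> C0" for x
    using less_le_trans[OF that(1) dist_to_set_le[OF that(2)]] Cons.prems(4)
    by (simp add: ennreal_less_iff dist_commute)
  then have sep: "separated (2 * \<gamma>) C'"
    using Cons.prems(3) by (auto simp: C'_def separated_def dist_commute)
  show ?case
  proof (cases "card C' > k")
    case True
    then show ?thesis
      using C' sep by (intro exI[of _ C']) auto
  next
    case False
    then have "greedy k \<gamma> qs C' = None"
      using Cons.prems(1) by (simp add: C'_def[symmetric] Let_def)
    then obtain D where "D \<subseteq> C' \<union> set qs" "finite D" "k < card D" "separated (2 * \<gamma>) D"
      using Cons.IH[OF _ C'(2) sep Cons.prems(4)] by blast
    then show ?thesis
      using C'(1) by (intro exI[of _ D]) auto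
  qed
qed simp

text \<open>The order of the representatives is existential in both verdicts, so one guess may
  satisfy \<open>accepts\<close> and \<open>rejects\<close> at once.\<close>

definition accepts :: "nat \<Rightarrow> 'a::metric_space state \<Rightarrow> real \<Rightarrow> 'a set \<Rightarrow> bool" where
  "accepts k \<sigma> \<gamma> C \<longleftrightarrow> card (attractors (\<sigma> \<gamma>)) \<le> k \<and>
     (\<exists>qs. set qs = reps (\<sigma> \<gamma>) \<and> greedy k \<gamma> qs {} = Some C)"

definition rejects :: "nat \<Rightarrow> 'a::metric_space state \<Rightarrow> real \<Rightarrow> bool" where
  "rejects k \<sigma> \<gamma> \<longleftrightarrow> k < card (attractors (\<sigma> \<gamma>)) \<or>
     (\<exists>qs. set qs = reps (\<sigma> \<gamma>) \<and> greedy k \<gamma> qs {} = None)"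

text \<open>The split of the list records that every guess before the accepted one was rejected; in
  a sorted list these include all smaller guesses.\<close>

lemma scan_cases:
  assumes "result \<in> scan k \<sigma> \<gamma>s"
  shows "(result = None \<and> (\<forall>\<gamma>\<in>set \<gamma>s. rejects k \<sigma> \<gamma>)) \<or>
    (\<exists>ys \<gamma> zs C. \<gamma>s = ys @ \<gamma> # zs \<and> result = Some C \<and> accepts k \<sigma> \<gamma> C \<and> (\<forall>\<gamma>'\<in>set ys. rejects k \<sigma> \<gamma>'))"
  using assms
proof (induction \<gamma>s)
  case (Cons \<gamma> \<gamma>s)
  have "(\<exists>C. result = Some C \<and> accepts k \<sigma> \<gamma> C) \<or> (rejects k \<sigma> \<gamma> \<and> result \<in> scan k \<sigma> \<gamma>s)"
  proof (cases "card (attractors (\<sigma> \<gamma>)) \<le> k")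
    case True
    then obtain qs where qs: "set qs = reps (\<sigma> \<gamma>)"
      "result \<in> (case greedy k \<gamma> qs {} of Some C \<Rightarrow> {Some C} | None \<Rightarrow> scan k \<sigma> \<gamma>s)"
      using Cons.prems by auto
    then show ?thesis
      using True by (cases "greedy k \<gamma> qs {}") (auto simp: accepts_def rejects_def)
  next
    case False
    then show ?thesis
      using Cons.prems by (simp add: rejects_def)
  qed
  then show ?case
  proof (elim disjE exE conjE)
    fix C assume "result = Some C" "accepts k \<sigma> \<gamma> C"
    then show ?thesis
      by (intro disjI2 exI[of _ "[]"]) auto
  next
    assume rej: "rejects k \<sigma> \<gamma>" and "result \<in> scan k \<sigma> \<gamma>s"
    from Cons.IH[OF this(2)] show ?thesis
    proof (elim disjE exE conjE)
      fix ys \<gamma>' zs C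
      assume "\<gamma>s = ys @ \<gamma>' # zs" "result = Some C" "accepts k \<sigma> \<gamma>' C" "\<forall>\<gamma>'\<in>set ys. rejects k \<sigma> \<gamma>'"
      then show ?thesis
        using rej by (intro disjI2 exI[of _ "\<gamma> # ys"]) auto
    qed (use rej in auto)
  qed
qed simp

lemma scan_nonempty:
  assumes "\<And>\<gamma>. \<gamma> \<in> set \<gamma>s \<Longrightarrow> finite (reps (\<sigma> \<gamma>))"
  shows "scan k \<sigma> \<gamma>s \<noteq> {}"
  using assms
proof (induction \<gamma>s)
  case (Cons \<gamma> \<gamma>s)
  obtain qs where "set qs = reps (\<sigma> \<gamma>)" "distinct qs"
    using finite_distinct_list[of "reps (\<sigma> \<gamma>)"] Cons.prems by auto
  moreover have "scan k \<sigma> \<gamma>s \<noteq> {}"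
    using Cons by simp
  ultimately show ?case
    by (auto split: option.split intro!: exI[of _ qs])
qed simp

text \<open>Both grounds for rejection give the same certificate: the attractors are separated by
  coherence, and a failed greedy run collects separated representatives.\<close>

lemma rejects_separated:
  assumes "rejects k \<sigma> \<gamma>" "coherent t_del \<gamma> P (\<sigma> \<gamma>)" "finite P" "0 \<le> \<gamma>"
    and "attractors (\<sigma> \<gamma>) \<subseteq> S" "reps (\<sigma> \<gamma>) \<subseteq> S"
  obtains D where "D \<subseteq> S" "finite D" "k < card D" "separated (2 * \<gamma>) D"
proof -
  consider "k < card (attractors (\<sigma> \<gamma>))"
    | qs where "set qs = reps (\<sigma> \<gamma>)" "greedy k \<gamma> qs {} = None"
    using assms(1) by (auto simp: rejects_def)
  then show thesis
  proof cases
    case 1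
    then show thesis
      using that[of "attractors (\<sigma> \<gamma>)"] assms by (auto simp: coherent_def intro: finite_subset)
  next
    case 2
    have "separated (2 * \<gamma>) ({} :: 'a set)"
      by (simp add: separated_def)
    then obtain D where "D \<subseteq> set qs" "finite D" "k < card D" "separated (2 * \<gamma>) D"
      using greedy_None[OF 2(2)] \<open>0 \<le> \<gamma>\<close> by auto
    then show thesis
      using that[of D] 2(1) assms(6) by auto
  qed
qed

lemma accepts_coreset:
  assumes "accepts k \<sigma> \<gamma> C" "guess_inv k t_del \<gamma> P S (\<sigma> \<gamma>)" "0 \<le> \<gamma>"
  shows "C \<subseteq> reps (\<sigma> \<gamma>)" "card C \<le> k" "\<And>p. p \<in> S \<Longrightarrow> \<exists>c\<in>C. dist p c \<le> 6 * \<gamma>"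
proof -
  obtain qs where A: "card (attractors (\<sigma> \<gamma>)) \<le> k"
    and qs: "set qs = reps (\<sigma> \<gamma>)" "greedy k \<gamma> qs {} = Some C"
    using assms(1) by (auto simp: accepts_def)
  have C: "C \<subseteq> set qs \<and> card C \<le> k \<and> (\<forall>q\<in>set qs. \<exists>c\<in>C. dist q c \<le> 2 * \<gamma>)"
    using greedy_Some[OF qs(2)] \<open>0 \<le> \<gamma>\<close> by simp
  then show "C \<subseteq> reps (\<sigma> \<gamma>)" "card C \<le> k"
    using qs by auto
  fix p assume "p \<in> S"
  \<comment> \<open>With at most \<open>k\<close> attractors, \<open>outlived\<close> is
    impossible.\<close>
  then have "covered t_del \<gamma> (\<sigma> \<gamma>) p"
    using assms(2) A by (auto simp: guess_inv_def outlived_def)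
  then obtain r where r: "r \<in> reps (\<sigma> \<gamma>)" "dist p r \<le> 4 * \<gamma>"
    using covered_near_rep assms(2) unfolding guess_inv_def by metis
  then obtain c where "c \<in> C" "dist r c \<le> 2 * \<gamma>"
    using C qs(1) by blast
  then show "\<exists>c\<in>C. dist p c \<le> 6 * \<gamma>"
    using r(2) dist_triangle[of p c r] by (intro bexI[of _ c]) auto
qed

section \<open>The stream of arrivals\<close>

text \<open>The state before time \<open>\<tau>\<close> has seen all events up to
  \<open>\<tau> - 1\<close>; a point is active at that time iff its deletion time is at least
  \<open>\<tau>\<close>, whence the non-strict bound in the set to be covered.\<close>

lemma states_before_inv:
  assumes "finite X" "inj_on t_arr X" "\<forall>\<gamma>\<in>\<Gamma>. 0 \<le> \<gamma>"
    and "\<sigma> \<in> states_before \<Gamma> k X t_arr t_del \<tau>" "\<gamma> \<in> \<Gamma>"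
  shows "guess_inv k t_del \<gamma> {x \<in> X. t_arr x < \<tau>} {x \<in> X. t_arr x < \<tau> \<and> \<tau> \<le> t_del x} (\<sigma> \<gamma>)"
  using assms(4)
proof (induction \<tau> arbitrary: \<sigma>)
  case 0
  then show ?case
    using assms(5) by (auto simp: initial_state_def guess_inv_def coherent_def separated_def)
next
  case (Suc \<tau>)
  let ?P = "\<lambda>\<tau>. {x \<in> X. t_arr x < \<tau>}" and ?Q = "\<lambda>\<tau>. {x \<in> X. t_arr x < \<tau> \<and> \<tau> \<le> t_del x}"
  obtain \<sigma>0 \<sigma>1 where \<sigma>0: "\<sigma>0 \<in> states_before \<Gamma> k X t_arr t_del \<tau>"
    and \<sigma>1: "\<sigma>1 \<in> arrivals \<Gamma> k X t_arr t_del \<tau> \<sigma>0" and \<sigma>: "\<sigma> = \<sigma>1 \<or> \<sigma> = purge \<Gamma> t_del \<tau> \<sigma>1"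
    using Suc.prems by auto
  note inv0 = Suc.IH[OF \<sigma>0]
  have inv1: "guess_inv k t_del \<gamma> (?P (Suc \<tau>)) (?Q (Suc \<tau>)) (\<sigma>1 \<gamma>)"
  proof (cases "\<exists>p\<in>X. t_arr p = \<tau>")
    case True
    then obtain p where p: "p \<in> X" "t_arr p = \<tau>" "\<sigma>1 \<in> update \<Gamma> k t_arr t_del p \<sigma>0"
      using \<sigma>1 by (auto simp: arrivals_def)
    then have upd: "\<sigma>1 \<gamma> \<in> update_guess k t_arr t_del \<gamma> p (\<sigma>0 \<gamma>)"
      using assms(5) by (auto simp: update_def)
    \<comment> \<open>Distinct arrival times: the step at time \<open>\<tau>\<close> adds exactly
      one point.\<close>
    have only: "x = p" if "x \<in> X" "t_arr x = \<tau>" for x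
      using assms(2) p that by (auto simp: inj_on_def)
    have P: "?P (Suc \<tau>) = insert p (?P \<tau>)"
      using p(1,2) by (auto simp: less_Suc_eq dest: only)
    have fin: "finite (?P \<tau>)" and new: "p \<notin> ?P \<tau>"
      using assms(1) p(2) by auto
    have Q: "?Q (Suc \<tau>) \<subseteq> insert p {q \<in> ?Q \<tau>. t_arr p < t_del q}"
      using p(2) by (auto simp: less_Suc_eq dest: only)
    show ?thesis
      unfolding P using inv0 fin new bspec[OF assms(3,5)] Q upd by (rule guess_inv_update)
  next
    case False
    then have P: "?P (Suc \<tau>) = ?P \<tau>" and Q: "?Q (Suc \<tau>) \<subseteq> ?Q \<tau>" and "\<sigma>1 = \<sigma>0"
      using \<sigma>1 by (auto simp: arrivals_def less_Suc_eq)
    show ?thesis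
      unfolding P \<open>\<sigma>1 = \<sigma>0\<close> using inv0 Q by (rule guess_inv_mono)
  qed
  moreover have "guess_inv k t_del \<gamma> (?P (Suc \<tau>)) (?Q (Suc \<tau>)) (purge \<Gamma> t_del \<tau> \<sigma>1 \<gamma>)"
  proof -
    have "guess_inv k t_del \<gamma> (?P (Suc \<tau>)) (?Q (Suc \<tau>)) (expire t_del \<tau> (\<sigma>1 \<gamma>))"
      using inv1 by (rule guess_inv_expire) (use assms(1) in auto)
    then show ?thesis
      using assms(5) by (simp add: purge_def)
  qed
  ultimately show ?case
    using \<sigma> by blast
qed

lemma states_before_nonempty:
  assumes "finite X" "inj_on t_arr X" "\<forall>\<gamma>\<in>\<Gamma>. 0 \<le> \<gamma>"
  shows "states_before \<Gamma> k X t_arr t_del \<tau> \<noteq> {}"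
proof (induction \<tau>)
  case (Suc \<tau>)
  then obtain \<sigma> where \<sigma>: "\<sigma> \<in> states_before \<Gamma> k X t_arr t_del \<tau>"
    by blast
  have "finite (attractors (\<sigma> \<gamma>))" if "\<gamma> \<in> \<Gamma>" for \<gamma>
    using states_before_inv[OF assms \<sigma> that] assms(1)
    by (auto simp: guess_inv_def coherent_def intro: finite_subset)
  then have "update \<Gamma> k t_arr t_del p \<sigma> \<noteq> {}" for p
    by (simp add: update_def PiE_eq_empty_iff update_guess_nonempty)
  then have "arrivals \<Gamma> k X t_arr t_del \<tau> \<sigma> \<noteq> {}"
    by (auto simp: arrivals_def)
  then show ?case
    using \<sigma> by auto
qed simp

text \<open>After the purge only active points remain stored, so the centers are active and a
  rejection bounds the optimum of the active set itself.\<close>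

lemma query_state_inv:
  assumes "finite X" "inj_on t_arr X" "\<forall>\<gamma>\<in>\<Gamma>. 0 \<le> \<gamma>"
    and "\<sigma> \<in> states_before \<Gamma> k X t_arr t_del (Suc t)" "\<gamma> \<in> \<Gamma>"
  defines "s \<equiv> purge \<Gamma> t_del t \<sigma> \<gamma>" and "S \<equiv> active X t_arr t_del t"
  shows "guess_inv k t_del \<gamma> X S s" "attractors s \<subseteq> S" "reps s \<subseteq> S"
proof -
  let ?P = "{x \<in> X. t_arr x < Suc t}"
  have s: "s = expire t_del t (\<sigma> \<gamma>)"
    using assms(5) by (simp add: s_def purge_def)
  have S: "{x \<in> X. t_arr x < Suc t \<and> Suc t \<le> t_del x} = S"
    by (auto simp: S_def active_def)
  have "guess_inv k t_del \<gamma> ?P S (\<sigma> \<gamma>)"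
    using states_before_inv[OF assms(1-5)] unfolding S by simp
  then have inv: "guess_inv k t_del \<gamma> ?P S s"
    unfolding s by (rule guess_inv_expire) (use assms(1) in \<open>auto simp: S_def active_def\<close>)
  then show "guess_inv k t_del \<gamma> X S s"
    by (auto simp: guess_inv_def coherent_def)
  show "attractors s \<subseteq> S" "reps s \<subseteq> S"
    using inv by (auto simp: guess_inv_def coherent_def s expire_def S_def active_def)
qed

section \<open>The guesses\<close>

lemma distances_finite_nonempty:
  fixes X :: "'a::metric_space set"
  assumes "finite X" "card X \<ge> 2"
  shows "finite {dist p q | p q. p \<in> X \<and> q \<in> X \<and> p \<noteq> q}" (is "finite ?D")
    and "{dist p q | p q. p \<in> X \<and> q \<in> X \<and> p \<noteq> q} \<noteq> {}"
proof -
  have "?D \<subseteq> (\<lambda>(p, q). dist p q) ` (X \<times> X)"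
    by auto
  then show "finite ?D"
    using assms(1) by (meson finite_SigmaI finite_imageI finite_subset)
  show "?D \<noteq> {}"
    using assms(2) by (auto simp: card_le_Suc_iff numeral_2_eq_2)
qed

lemma
  fixes X :: "'a::metric_space set"
  assumes "finite X" "p \<in> X" "q \<in> X" "p \<noteq> q"
  shows d_min_le: "d_min X \<le> dist p q" and le_d_max: "dist p q \<le> d_max X"
proof -
  have "card X \<ge> 2"
    using card_mono[of X "{p, q}"] assms by auto
  note fin = distances_finite_nonempty(1)[OF assms(1) this]
  have "dist p q \<in> {dist p q | p q. p \<in> X \<and> q \<in> X \<and> p \<noteq> q}"
    using assms by auto
  then show "d_min X \<le> dist p q" "dist p q \<le> d_max X"
    unfolding d_min_def d_max_def by (rule Min_le[OF fin], rule Max_ge[OF fin])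
qed

lemma d_min_pos:
  assumes "finite X" "card X \<ge> 2"
  shows "0 < d_min X"
  using Min_in[OF distances_finite_nonempty[OF assms]] unfolding d_min_def by auto

lemma d_min_le_d_max:
  assumes "finite X" "card X \<ge> 2"
  shows "d_min X \<le> d_max X"
  unfolding d_min_def d_max_def using distances_finite_nonempty[OF assms]
  by (meson Max_in Min_le)

text \<open>With more than \<open>k\<close> points some point is not a center, and its distance to
  each center is at least \<open>d_min X\<close>.\<close>

lemma opt_radius_ge_d_min:
  assumes "finite X" "S \<subseteq> X" "k < card S"
  shows "ennreal (d_min X) \<le> opt_radius k S"
  unfolding opt_radius_def
proof (rule INF_greatest)
  fix C assume "C \<in> {C. C \<subseteq> S \<and> finite C \<and> card C \<le> k}"
  then have C: "C \<subseteq> S" "card C \<le> k"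
    by auto
  then obtain p where p: "p \<in> S" "p \<notin> C"
    using assms(3) by (metis not_le subsetI subset_antisym)
  have "ennreal (d_min X) \<le> dist_to_set p C"
    unfolding dist_to_set_def
  proof (intro INF_greatest ennreal_leI d_min_le)
    show "p \<noteq> q" if "q \<in> C" for q
      using that p by blast
  qed (use assms C p in auto)
  also have "\<dots> \<le> radius C S"
    unfolding radius_def using p(1) by (rule SUP_upper)
  finally show "ennreal (d_min X) \<le> radius C S" .
qed

lemma finite_guesses: "finite (guesses X \<epsilon>)"
proof -
  have "guesses X \<epsilon> = (\<lambda>i. (1 + \<epsilon> / 6) powi i) `
      {\<lfloor>log (1 + \<epsilon> / 6) (d_min X)\<rfloor>..\<lceil>log (1 + \<epsilon> / 6) (d_max X)\<rceil>}"
    by (auto simp: guesses_def Let_def)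
  then show ?thesis
    by simp
qed

lemma guesses_pos: "\<epsilon> > 0 \<Longrightarrow> \<gamma> \<in> guesses X \<epsilon> \<Longrightarrow> 0 < \<gamma>"
  by (auto simp: guesses_def Let_def)

lemma powi_le_iff_le_log:
  fixes b x :: real
  assumes "1 < b" "0 < x"
  shows "b powi i \<le> x \<longleftrightarrow> real_of_int i \<le> log b x"
  using assms by (simp add: le_log_iff powr_real_of_int' )

lemma le_powi_iff_log_le:
  fixes b x :: real
  assumes "1 < b" "0 < x"
  shows "x \<le> b powi i \<longleftrightarrow> log b x \<le> real_of_int i"
  using assms by (simp add: log_le_iff powr_real_of_int' )

text \<open>The floor puts the smallest guess at or below \<open>d_min X\<close>; for any other
  guess the exponent \<open>i - 1\<close> is still in range.\<close>

lemma guess_predecessor: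
  assumes "\<epsilon> > 0" "0 < d_min X" "\<gamma> \<in> guesses X \<epsilon>"
  shows "\<gamma> \<le> d_min X \<or> \<gamma> / (1 + \<epsilon> / 6) \<in> guesses X \<epsilon>"
proof -
  obtain i where i: "\<gamma> = (1 + \<epsilon> / 6) powi i"
    "\<lfloor>log (1 + \<epsilon> / 6) (d_min X)\<rfloor> \<le> i" "i \<le> \<lceil>log (1 + \<epsilon> / 6) (d_max X)\<rceil>"
    using assms(3) by (auto simp: guesses_def Let_def)
  show ?thesis
  proof (cases "i = \<lfloor>log (1 + \<epsilon> / 6) (d_min X)\<rfloor>")
    case True
    then show ?thesis
      using assms(1,2) by (simp add: i(1) powi_le_iff_le_log)
  next
    case False
    moreover have "\<gamma> / (1 + \<epsilon> / 6) = (1 + \<epsilon> / 6) powi (i - 1)"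
      using assms(1) by (simp add: i(1) power_int_diff)
    ultimately show ?thesis
      using i unfolding guesses_def Let_def by (intro disjI2 CollectI exI[of _ "i - 1"]) auto
  qed
qed

text \<open>The ceiling lifts the largest guess to at least \<open>d_max X\<close>; such a guess is
  never rejected, so a query always finds an answer.\<close>

lemma ex_guess_ge_d_max:
  assumes "\<epsilon> > 0" "finite X" "card X \<ge> 2"
  obtains \<gamma> where "\<gamma> \<in> guesses X \<epsilon>" "d_max X \<le> \<gamma>"
proof -
  let ?b = "1 + \<epsilon> / 6"
  have d: "0 < d_min X" "d_min X \<le> d_max X"
    using assms d_min_pos d_min_le_d_max by auto
  then have "log ?b (d_min X) \<le> log ?b (d_max X)"
    using assms(1) by simp
  then have "\<lfloor>log ?b (d_min X)\<rfloor> \<le> \<lceil>log ?b (d_max X)\<rceil>"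
    by linarith
  then have "?b powi \<lceil>log ?b (d_max X)\<rceil> \<in> guesses X \<epsilon>"
    by (auto simp: guesses_def Let_def)
  moreover have "d_max X \<le> ?b powi \<lceil>log ?b (d_max X)\<rceil>"
    using assms(1) d by (simp add: le_powi_iff_log_le)
  ultimately show thesis
    using that by blast
qed

section \<open>The approximation ratio of a query\<close>

lemma mem_prefix_if_less:
  fixes x y :: "'b::linorder"
  assumes "sorted (ys @ x # zs)" "y \<in> set (ys @ x # zs)" "y < x"
  shows "y \<in> set ys"
  using assms by (auto simp: sorted_append)

theorem theorem4p2:
  fixes X :: "'a::metric_space set"
    and t_arr t_del :: "'a \<Rightarrow> nat"
    and k t :: nat
    and \<epsilon> :: real
  assumes "finite X"
    and "card X \<ge> 2"
    and "k \<ge> 1"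
    and "\<epsilon> > 0"
    and "inj_on t_arr X"
    and "\<And>p. p \<in> X \<Longrightarrow> t_arr p < t_del p"
  shows "query_results X t_arr t_del k \<epsilon> t \<noteq> {} \<and>
    (\<forall>result \<in> query_results X t_arr t_del k \<epsilon> t. \<exists>C. result = Some C \<and>
       C \<subseteq> active X t_arr t_del t \<and> card C \<le> k \<and>
       (card (active X t_arr t_del t) \<notin> {2..k} \<longrightarrow>
          radius C (active X t_arr t_del t)
            \<le> ennreal (6 + \<epsilon>) * opt_radius k (active X t_arr t_del t)))"
proof -
  define \<Gamma> where "\<Gamma> = guesses X \<epsilon>"
  define S where "S = active X t_arr t_del t"
  have pos: "0 < \<gamma>" if "\<gamma> \<in> \<Gamma>" for \<gamma>
    using guesses_pos that assms(4) unfolding \<Gamma>_def by blast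
  then have nonneg: "\<forall>\<gamma>\<in>\<Gamma>. 0 \<le> \<gamma>"
    using less_imp_le by blast
  have fin\<Gamma>: "finite \<Gamma>"
    by (simp add: \<Gamma>_def finite_guesses)
  have SX: "S \<subseteq> X" "finite S"
    using assms(1) by (auto simp: S_def active_def)
  have results: "query_results X t_arr t_del k \<epsilon> t =
      (\<Union>\<sigma>\<in>states_before \<Gamma> k X t_arr t_del (Suc t). query \<Gamma> k t_del t \<sigma>)"
    by (simp add: query_results_def Let_def \<Gamma>_def)
  note state_inv = query_state_inv[where t = t and t_del = t_del and k = k, OF assms(1,5) nonneg, folded S_def]
  obtain \<sigma> where \<sigma>: "\<sigma> \<in> states_before \<Gamma> k X t_arr t_del (Suc t)"
    using states_before_nonempty[OF assms(1,5) nonneg] by blast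
  have "finite (reps (purge \<Gamma> t_del t \<sigma> \<gamma>))" if "\<gamma> \<in> \<Gamma>" for \<gamma>
    using state_inv(3)[OF \<sigma> that] SX(2) by (rule finite_subset)
  then have "query \<Gamma> k t_del t \<sigma> \<noteq> {}"
    unfolding query_def using fin\<Gamma> by (intro scan_nonempty) simp
  then have "query_results X t_arr t_del k \<epsilon> t \<noteq> {}"
    unfolding results using \<sigma> by blast
  moreover have "\<exists>C. result = Some C \<and> C \<subseteq> S \<and> card C \<le> k \<and>
      (card S \<notin> {2..k} \<longrightarrow> radius C S \<le> ennreal (6 + \<epsilon>) * opt_radius k S)"
    if res: "result \<in> query_results X t_arr t_del k \<epsilon> t" for result
  proof -
    obtain \<sigma>0 where \<sigma>0: "\<sigma>0 \<in> states_before \<Gamma> k X t_arr t_del (Suc t)" "result \<in> query \<Gamma> k t_del t \<sigma>0"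
      using res unfolding results by blast
    define \<sigma> where "\<sigma> = purge \<Gamma> t_del t \<sigma>0"
    note inv = state_inv[OF \<sigma>0(1), folded \<sigma>_def]
    have witness: "\<exists>D \<subseteq> S. finite D \<and> k < card D \<and> separated (2 * \<gamma>) D"
      if "\<gamma> \<in> \<Gamma>" "rejects k \<sigma> \<gamma>" for \<gamma>
      using rejects_separated[OF that(2) _ assms(1) bspec[OF nonneg that(1)] inv(2,3)] inv(1) that(1)
      unfolding guess_inv_def by metis
    \<comment> \<open>Since \<open>k \<ge> 1\<close>, rejecting a guess of at least
      \<open>d_max X\<close> would yield two points more than \<open>2 * d_max X\<close>
      apart.\<close>
    have "\<not> (\<forall>\<gamma>\<in>\<Gamma>. rejects k \<sigma> \<gamma>)"
    proof
      assume "\<forall>\<gamma>\<in>\<Gamma>. rejects k \<sigma> \<gamma>"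
      moreover obtain \<gamma> where \<gamma>: "\<gamma> \<in> \<Gamma>" "d_max X \<le> \<gamma>"
        using ex_guess_ge_d_max[OF assms(4,1,2)] unfolding \<Gamma>_def by blast
      ultimately obtain D where D: "D \<subseteq> S" "finite D" "k < card D" "separated (2 * \<gamma>) D"
        using witness by blast
      then have "card D \<ge> 2"
        using assms(3) by simp
      then obtain x y where xy: "x \<in> D" "y \<in> D" "x \<noteq> y"
        by (auto simp: card_le_Suc_iff numeral_2_eq_2)
      then have "2 * \<gamma> < d_max X"
        using D SX le_d_max[OF assms(1), of x y] by (force simp: separated_def)
      then show False
        using \<gamma> pos by force
    qed
    then obtain ys \<gamma> zs C where split: "sorted_list_of_set \<Gamma> = ys @ \<gamma> # zs" "result = Some C"
      and acc: "accepts k \<sigma> \<gamma> C" and rej: "\<forall>\<gamma>'\<in>set ys. rejects k \<sigma> \<gamma>'"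
      using scan_cases[of result k \<sigma> "sorted_list_of_set \<Gamma>"] \<sigma>0(2) fin\<Gamma>
      unfolding query_def \<sigma>_def[symmetric] by auto
    have set_eq: "set (ys @ \<gamma> # zs) = \<Gamma>" "sorted (ys @ \<gamma> # zs)"
      using fin\<Gamma> by (simp_all flip: split(1))
    then have \<gamma>: "\<gamma> \<in> \<Gamma>"
      by auto
    note C = accepts_coreset[OF acc inv(1)[OF \<gamma>] bspec[OF nonneg \<gamma>]]
    have CS: "C \<subseteq> S"
      using C(1) inv(3)[OF \<gamma>] by blast
    have rad: "radius C S \<le> ennreal (6 * \<gamma>)"
      using C(3) by (rule radius_leI)
    have "radius C S \<le> ennreal (6 + \<epsilon>) * opt_radius k S" if card: "card S \<notin> {2..k}"
    proof (cases "k < card S")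
      case True
      from guess_predecessor[OF assms(4) d_min_pos[OF assms(1,2)] \<gamma>[unfolded \<Gamma>_def]]
      have "ennreal (\<gamma> / (1 + \<epsilon> / 6)) \<le> opt_radius k S"
      proof
        assume "\<gamma> \<le> d_min X"
        then have "\<gamma> / (1 + \<epsilon> / 6) \<le> d_min X"
          using assms(4) pos[OF \<gamma>] by (simp add: field_simps) (smt (verit) mult_nonneg_nonneg)
        then show ?thesis
          using opt_radius_ge_d_min[OF assms(1) SX(1) True] ennreal_leI order_trans by blast
      next
        assume pred: "\<gamma> / (1 + \<epsilon> / 6) \<in> guesses X \<epsilon>"
        \<comment> \<open>Being smaller, the predecessor was scanned before \<open>\<gamma>\<close>
          and rejected.\<close>
        have "\<gamma> / (1 + \<epsilon> / 6) < \<gamma>"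
          using assms(4) pos[OF \<gamma>] by (simp add: field_simps)
        then have "\<gamma> / (1 + \<epsilon> / 6) \<in> set ys"
          using mem_prefix_if_less[OF set_eq(2)] pred unfolding set_eq(1) \<Gamma>_def by blast
        then obtain D where "D \<subseteq> S" "finite D" "k < card D" "separated (2 * (\<gamma> / (1 + \<epsilon> / 6))) D"
          using witness rej pred unfolding \<Gamma>_def by blast
        then show ?thesis
          using nonneg pred unfolding \<Gamma>_def by (intro opt_radius_ge_separated) auto
      qed
      then have "ennreal (6 + \<epsilon>) * ennreal (\<gamma> / (1 + \<epsilon> / 6)) \<le> ennreal (6 + \<epsilon>) * opt_radius k S"
        by (rule mult_left_mono) simp
      \<comment> \<open>Here the choice of \<open>\<epsilon> / 6\<close> pays off:
        \<open>6 + \<epsilon> = 6 * (1 + \<epsilon> / 6)\<close>.\<close>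
      moreover have "ennreal (6 + \<epsilon>) * ennreal (\<gamma> / (1 + \<epsilon> / 6)) = ennreal (6 * \<gamma>)"
        using assms(4) pos[OF \<gamma>] by (subst ennreal_mult[symmetric]) (auto simp: field_simps)
      ultimately show ?thesis
        using rad by simp
    next
      case False
      then have "card S \<le> 1"
        using card by auto
      then have single: "x = y" if "x \<in> S" "y \<in> S" for x y
        using that SX(2) by (auto simp: card_le_Suc0_iff_eq)
      have "\<exists>c\<in>C. dist p c \<le> 0" if p: "p \<in> S" for p
      proof -
        \<comment> \<open>The coverage bound serves only to show that \<open>C\<close> is nonempty;
          as a subset of the singleton \<open>S\<close> it then contains \<open>p\<close>.\<close>
        obtain c where "c \<in> C"
          using C(3)[OF p] by blast
        moreover from this have "c = p"
          using single CS p by blast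
        ultimately show ?thesis
          by auto
      qed
      then have "radius C S \<le> ennreal 0"
        by (rule radius_leI)
      then show ?thesis
        by simp
    qed
    then show ?thesis
      using split(2) CS C(2) by blast
  qed
  ultimately show ?thesis
    unfolding S_def by blast
qed

end
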